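(* Let $X$ be a non-empty compact metric space and let $F$ be a closed relation on $X$. If the CR-dynamical system $(X,F)$ is $\sigma$-transitive, then $(X_F^+,\sigma_F^+)$ is transitive.
   Context: A closed relation on $X$ is a closed subset $F\subseteq X\times X$; the pair $(X,F)$ is then called a CR-dynamical system. The Mahavier product of $F$ is $X_F^+=\{(x_1,x_2,x_3,\ldots)\in\prod_{i=1}^\infty X : (x_i,x_{i+1})\in F\text{ for each positive integer } i\}$ with the subspace topology, and $\sigma_F^+(x_1,x_2,x_3,\ldots)=(x_2,x_3,x_4,\ldots)$. For $\mathbf x=(x_1,x_2,\ldots)$, $\pi_k(\mathbf x)=x_k$. $(X,F)$ is $\sigma$-transitive if there is a countable collection $\mathcal U=\{U_1,U_2,U_3,\ldots\}$ of open sets in $\prod_{i=1}^\infty X$ such that (1) for each positive integer $j$ there are a positive integer $m_j$ and open sets $U_1^j,\ldots,U_{m_j}^j$ in $X$ with $U_j=U_1^j\times\cdots\times U_{m_j}^j\times\prod_{i=m_j+1}^\infty X$; (2) for each open set $V$ in $\prod_{i=1}^\infty X$ with $V\cap X_F^+\neq\emptyset$ and each $\mathbf t\in V\cap X_F^+$ there is a positive integer $j$ with $\mathbf t\in U_j\subseteq V$; (3) there is a sequence $(\mathbf x_j)$ of points in $X_F^+$ such that for each positive integer $j$, $\mathbf x_j\in U_j$ and there is a positive integer $\ell_j>m_j$ with $\pi_{\ell_j}(\mathbf x_j)=\pi_1(\mathbf x_{j+1})$. A dynamical system $(Y,f)$ is transitive if for all non-empty open $U,V\subseteq Y$ there is a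 non-negative integer $n$ with $f^n(U)\cap V\neq\emptyset$. *)

theory Defs
  imports "HOL-Analysis.Analysis"
begin

definition closed_relation :: "'a topology \<Rightarrow> ('a \<times> 'a) set \<Rightarrow> bool" where
  "closed_relation X F \<longleftrightarrow> closedin (prod_topology X X) F"

text \<open>Sequences are indexed from 0: the paper's coordinate \<open>x\<^sub>k\<close>, for \<open>k \<ge> 1\<close>, is \<open>x (k - 1)\<close>.\<close>

definition seq_space :: "'a topology \<Rightarrow> (nat \<Rightarrow> 'a) topology" where
  "seq_space X = product_topology (\<lambda>_. X) UNIV"

definition mahavier_product :: "'a topology \<Rightarrow> ('a \<times> 'a) set \<Rightarrow> (nat \<Rightarrow> 'a) set" where
  "mahavier_product X F = {x \<in> topspace (seq_space X). \<forall>i. (x i, x (Suc i)) \<in> F}"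

definition mahavier_space :: "'a topology \<Rightarrow> ('a \<times> 'a) set \<Rightarrow> (nat \<Rightarrow> 'a) topology" where
  "mahavier_space X F = subtopology (seq_space X) (mahavier_product X F)"

definition shift :: "(nat \<Rightarrow> 'a) \<Rightarrow> nat \<Rightarrow> 'a" where
  "shift x = (\<lambda>i. x (Suc i))"

text \<open>
  The numbers \<open>m j\<close> are bound outside all conditions because the last one refers to the
  lengths chosen in the first; the enumeration \<open>U\<close> may repeat sets. Since indices start at 0,
  the coordinates constrained by \<open>U j\<close> are those below \<open>m j\<close>, and the coordinate at (1-based)
  position \<open>l\<close> is \<open>x j (l - 1)\<close>.
\<close>

definition sigma_transitive :: "'a topology \<Rightarrow> ('a \<times> 'a) set \<Rightarrow> bool" where
  "sigma_transitive X F \<longleftrightarrow>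
     (\<exists>(U :: nat \<Rightarrow> (nat \<Rightarrow> 'a) set) (m :: nat \<Rightarrow> nat).
        (\<forall>j. openin (seq_space X) (U j)) \<and>
        (\<forall>j. m j > 0 \<and>
           (\<exists>W. (\<forall>i<m j. openin X (W i)) \<and>
                U j = (\<Pi>\<^sub>E i\<in>UNIV. if i < m j then W i else topspace X))) \<and>
        (\<forall>V. openin (seq_space X) V \<and> V \<inter> mahavier_product X F \<noteq> {} \<longrightarrow>
           (\<forall>t \<in> V \<inter> mahavier_product X F. \<exists>j. t \<in> U j \<and> U j \<subseteq> V)) \<and>
        (\<exists>x. (\<forall>j. x j \<in> mahavier_product X F) \<and>
             (\<forall>j. x j \<in> U j \<and> (\<exists>l>m j. x j (l - 1) = x (Suc j) 0))))"

definition transitive_system :: "'a topology \<Rightarrow> ('a \<Rightarrow> 'a) \<Rightarrow> bool" where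
  "transitive_system Y f \<longleftrightarrow>
     (\<forall>U V. openin Y U \<and> U \<noteq> {} \<and> openin Y V \<and> V \<noteq> {} \<longrightarrow>
        (\<exists>n. (f ^^ n) ` U \<inter> V \<noteq> {}))"

text \<open>The shift is a continuous self-map of the Mahavier product, so it forms a dynamical system.\<close>

lemma continuous_map_shift:
  "continuous_map (mahavier_space X F) (mahavier_space X F) shift"
proof -
  have "continuous_map (seq_space X) (seq_space X) shift"
    unfolding seq_space_def shift_def
    by (auto simp: continuous_map_componentwise_UNIV intro: continuous_map_product_projection)
  then have "continuous_map (mahavier_space X F) (seq_space X) shift"
    unfolding mahavier_space_def by (rule continuous_map_from_subtopology)
  moreover have "shift ` topspace (mahavier_space X F) \<subseteq> mahavier_product X F"
    by (auto simp: mahavier_space_def mahavier_product_def seq_space_def shift_def PiE_UNIV_domain)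
  ultimately show ?thesis
    by (subst (2) mahavier_space_def) (auto simp: continuous_map_in_subtopology)
qed

end

theory Submission imports Defs begin

text \<open>
  Chaining the points \<open>x j, x (j + 1), \<dots>, x k\<close> yields a point of the Mahavier product that lies
  in \<open>U j\<close> and is carried to \<open>x k \<in> U k\<close> by a power of the shift; this settles transitivity
  for basic sets \<open>U j\<close>, \<open>U k\<close> with \<open>j \<le> k\<close>. To arrange \<open>j \<le> k\<close>, note that the \<open>U k\<close> form a
  neighbourhood base in the full product, not merely in the Mahavier product: unless the space
  is a single point, the full product has no isolated points, so every neighbourhood contains
  members \<open>U k\<close> of arbitrarily large index.
\<close>

lemma funpow_shift: "(shift ^^ n) x = (\<lambda>i. x (i + n))"
  by (induction n) (simp_all add: shift_def)

lemma topspace_seq_space: "x \<in> topspace (seq_space X) \<longleftrightarrow> (\<forall>i. x i \<in> topspace X)"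
  by (auto simp: seq_space_def PiE_iff)

lemma mem_mahavier_product:
  "x \<in> mahavier_product X F \<longleftrightarrow> (\<forall>i. x i \<in> topspace X) \<and> (\<forall>i. (x i, x (Suc i)) \<in> F)"
  by (simp add: mahavier_product_def topspace_seq_space)

text \<open>Pairs away from the seam are consecutive pairs of \<open>x\<close> or of
  \<open>y\<close>. At the seam, where \<open>Suc i = p\<close>, the pair is
  \<open>(x i, y 0)\<close>, and \<open>y 0 = x p\<close> makes it a pair of
  \<open>x\<close>.\<close>

lemma mahavier_product_append:
  assumes "x \<in> mahavier_product X F" "y \<in> mahavier_product X F" "x p = y 0"
  shows "(\<lambda>i. if i < p then x i else y (i - p)) \<in> mahavier_product X F"
proof -
  have "(if i < p then x i else y (i - p), if Suc i < p then x (Suc i) else y (Suc i - p)) \<in> F"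
    for i
  proof -
    consider "Suc i < p" | "Suc i = p" | "p \<le> i"
      by linarith
    then show ?thesis
    proof cases
      case 2
      then show ?thesis
        using assms by (metis diff_self_eq_0 lessI less_irrefl mem_mahavier_product)
    qed (use assms in \<open>auto simp: mem_mahavier_product Suc_diff_le\<close>)
  qed
  then show ?thesis
    using assms by (auto simp: mem_mahavier_product)
qed

text \<open>Downward induction from \<open>k\<close>: the chain for \<open>Suc j\<close> is preceded
  by the first \<open>p\<close> entries of \<open>x j\<close>. Since \<open>p \<ge> m j\<close>, the
  entries below \<open>m j\<close> remain those of \<open>x j\<close>.\<close>

lemma mahavier_product_chain:
  fixes x :: "nat \<Rightarrow> nat \<Rightarrow> 'a" and m :: "nat \<Rightarrow> nat"
  assumes x: "\<And>j. x j \<in> mahavier_product X F"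
    and m: "\<And>j. m j > 0"
    and link: "\<And>j. \<exists>p\<ge>m j. x j p = x (Suc j) 0"
    and "j \<le> k"
  shows "\<exists>y\<in>mahavier_product X F. (\<forall>i<m j. y i = x j i) \<and> (\<exists>n. (shift ^^ n) y = x k)"
  using \<open>j \<le> k\<close>
proof (induction j rule: inc_induct)
  case base
  show ?case
    using x[of k] by (intro bexI[of _ "x k"] conjI exI[of _ 0]) auto
next
  case (step j)
  then obtain y n where y: "y \<in> mahavier_product X F" "\<forall>i<m (Suc j). y i = x (Suc j) i"
    and n: "(shift ^^ n) y = x k"
    by blast
  obtain p where p: "p \<ge> m j" "x j p = x (Suc j) 0"
    using link by blast
  let ?z = "\<lambda>i. if i < p then x j i else y (i - p)"
  \<comment> \<open>The seam fits because \<open>m (Suc j) > 0\<close> forces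
    \<open>y 0 = x (Suc j) 0\<close>, which equals \<open>x j p\<close>.\<close>
  have "?z \<in> mahavier_product X F"
    using x y m p by (intro mahavier_product_append) auto
  moreover have "(shift ^^ (n + p)) ?z = x k"
    using n by (simp add: funpow_shift fun_eq_iff)
  ultimately show ?case
    using p by (intro bexI[of _ ?z] conjI exI[of _ "n + p"]) auto
qed

lemma mem_box_if_agree_below:
  assumes "x \<in> (\<Pi>\<^sub>E i\<in>UNIV. if i < n then W i else S)"
    and "\<And>i. i < n \<Longrightarrow> y i = x i" and "\<And>i. y i \<in> S"
  shows "y \<in> (\<Pi>\<^sub>E i\<in>UNIV. if i < n then W i else S)"
proof -
  have "y i \<in> (if i < n then W i else S)" for i
    using assms(2,3)[of i] PiE_mem[OF assms(1), of i] by (cases "i < n") auto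
  then show ?thesis
    by (simp add: PiE_iff)
qed

lemma box_base_index_unbounded:
  fixes U :: "nat \<Rightarrow> (nat \<Rightarrow> 'a) set" and m :: "nat \<Rightarrow> nat"
  assumes "t1_space X"
    and nontriv: "\<And>a. topspace X \<noteq> {a}"
    and box: "\<And>j. \<exists>W. U j = (\<Pi>\<^sub>E i\<in>UNIV. if i < m j then W i else topspace X)"
    and base: "\<And>V. openin (seq_space X) V \<Longrightarrow> t \<in> V \<Longrightarrow> \<exists>j. t \<in> U j \<and> U j \<subseteq> V"
    and V: "openin (seq_space X) V" "t \<in> V"
  shows "\<exists>k\<ge>K. t \<in> U k \<and> U k \<subseteq> V"
proof -
  \<comment> \<open>Coordinate \<open>N\<close> is left free by every \<open>U j\<close> with
    \<open>j < K\<close>, as such a box constrains only indices below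
    \<open>m j \<le> N\<close>.\<close>
  define N where "N = Max (m ` {..K})"
  have N: "m j \<le> N" if "j < K" for j
    using that unfolding N_def by (intro Max_ge) auto
  have t: "t i \<in> topspace X" for i
    using V openin_subset topspace_seq_space by blast
  then obtain b where b: "b \<in> topspace X" "b \<noteq> t N"
    using nontriv[of "t N"] by blast
  \<comment> \<open>This neighbourhood of \<open>t\<close> forbids the value \<open>b\<close> at
    coordinate \<open>N\<close>, so no box that is free there and contains \<open>t\<close> fits
    inside it.\<close>
  let ?B = "{y \<in> topspace (seq_space X). y N \<in> topspace X - {b}}"
  have "openin X (topspace X - {b})"
    using \<open>t1_space X\<close> b by (simp add: t1_space_closedin_singleton openin_diff)
  then have "openin (seq_space X) ?B"
    unfolding seq_space_def
    by (intro openin_continuous_map_preimage)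
      (auto intro: continuous_map_product_projection)
  then have "openin (seq_space X) (V \<inter> ?B)"
    using V by blast
  moreover have "t \<in> V \<inter> ?B"
    using V b t by (auto simp: topspace_seq_space)
  ultimately obtain k where k: "t \<in> U k" "U k \<subseteq> V \<inter> ?B"
    using base by blast
  have "k \<ge> K"
  proof (rule ccontr)
    assume "\<not> k \<ge> K"
    then have "m k \<le> N"
      using N by simp
    obtain W where "U k = (\<Pi>\<^sub>E i\<in>UNIV. if i < m k then W i else topspace X)"
      using box by blast
    then have "t(N := b) \<in> U k"
      using mem_box_if_agree_below[of t "m k" W "topspace X" "t(N := b)"] k(1) b t \<open>m k \<le> N\<close>
      by simp
    then show False
      using k(2) by auto
  qed
  then show ?thesis
    using k by blast
qed

lemma sigma_transitive_imp_transitive_system: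
  assumes "t1_space X" "sigma_transitive X F"
  shows "transitive_system (mahavier_space X F) shift"
proof -
  let ?M = "mahavier_product X F"
  obtain U :: "nat \<Rightarrow> (nat \<Rightarrow> 'a) set" and m x where
    U: "\<forall>j. m j > 0 \<and> (\<exists>W. (\<forall>i<m j. openin X (W i)) \<and>
          U j = (\<Pi>\<^sub>E i\<in>UNIV. if i < m j then W i else topspace X))"
    and U_base: "\<forall>V. openin (seq_space X) V \<and> V \<inter> ?M \<noteq> {} \<longrightarrow>
          (\<forall>t\<in>V \<inter> ?M. \<exists>j. t \<in> U j \<and> U j \<subseteq> V)"
    and x: "\<forall>j. x j \<in> ?M"
    and x_link: "\<forall>j. x j \<in> U j \<and> (\<exists>l>m j. x j (l - 1) = x (Suc j) 0)"
    using assms(2) unfolding sigma_transitive_def by (elim exE conjE) (rule that)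
  have box: "\<exists>W. U j = (\<Pi>\<^sub>E i\<in>UNIV. if i < m j then W i else topspace X)" for j
    using U by blast
  have m: "m j > 0" for j
    using U by blast
  have base: "\<exists>j. t \<in> U j \<and> U j \<subseteq> V" if "openin (seq_space X) V" "t \<in> V" "t \<in> ?M" for V t
    using U_base that by blast
  have x_U: "x j \<in> U j" for j
    using x_link by blast
  \<comment> \<open>Passing from the 1-based position \<open>l\<close> to the index
    \<open>p = l - 1\<close> turns \<open>l > m j\<close> into \<open>p \<ge> m j\<close>.\<close>
  have link: "\<exists>p\<ge>m j. x j p = x (Suc j) 0" for j
  proof -
    obtain l where "l > m j" "x j (l - 1) = x (Suc j) 0"
      using x_link by blast
    then show ?thesis
      by (intro exI[of _ "l - 1"]) auto
  qed
  have "\<exists>n. (shift ^^ n) ` A \<inter> B \<noteq> {}"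
    if AB: "openin (mahavier_space X F) A" "A \<noteq> {}" "openin (mahavier_space X F) B" "B \<noteq> {}"
    for A B
  proof -
    obtain V V' where V: "openin (seq_space X) V" "A = V \<inter> ?M"
      and V': "openin (seq_space X) V'" "B = V' \<inter> ?M"
      using AB by (auto simp: mahavier_space_def openin_subtopology)
    obtain s t where s: "s \<in> A" and t: "t \<in> B"
      using AB by blast
    show ?thesis
    proof (cases "\<exists>a. topspace X = {a}")
      \<comment> \<open>All sequences over a single point coincide, so \<open>A\<close> and
        \<open>B\<close> already meet and \<open>n = 0\<close> works.\<close>
      case True
      then have "s = t"
        using s t V V' by (auto simp: fun_eq_iff mem_mahavier_product)
      then show ?thesis
        using s t by (intro exI[of _ 0]) auto
    next
      case False
      obtain j where j: "U j \<subseteq> V"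
        using base V s by blast
      \<comment> \<open>With \<open>j\<close> fixed first, it serves as the lower bound
        \<open>K\<close> for the index of a box around \<open>t\<close>.\<close>
      have "\<exists>k\<ge>j. t \<in> U k \<and> U k \<subseteq> V'"
        by (rule box_base_index_unbounded[OF assms(1) _ box]) (use False base V' t in auto)
      then obtain k where k: "k \<ge> j" "U k \<subseteq> V'"
        by blast
      have "\<exists>y\<in>?M. (\<forall>i<m j. y i = x j i) \<and> (\<exists>n. (shift ^^ n) y = x k)"
        by (rule mahavier_product_chain[where m = m]) (use x m link k(1) in auto)
      then obtain y n where y: "y \<in> ?M" "\<forall>i<m j. y i = x j i" and n: "(shift ^^ n) y = x k"
        by blast
      obtain W where "U j = (\<Pi>\<^sub>E i\<in>UNIV. if i < m j then W i else topspace X)"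
        using box by blast
      \<comment> \<open>\<open>y\<close> agrees with \<open>x j\<close>, a point of
        \<open>U j\<close>, on all coordinates that this box constrains.\<close>
      then have "y \<in> U j"
        using mem_box_if_agree_below[of "x j" "m j" W "topspace X" y] x_U[of j] y
        by (simp add: mem_mahavier_product)
      then have "y \<in> A"
        using j V y by blast
      then have "x k \<in> (shift ^^ n) ` A"
        using n by (metis imageI)
      moreover have "x k \<in> B"
        using k(2) x x_U[of k] V'(2) by auto
      ultimately show ?thesis
        by blast
    qed
  qed
  then show ?thesis
    unfolding transitive_system_def by blast
qed

theorem theorem5p8:
  fixes X :: "'a set" and d :: "'a \<Rightarrow> 'a \<Rightarrow> real" and F :: "('a \<times> 'a) set"
  assumes "Metric_space X d"
    and "X \<noteq> {}"
    and "compact_space (Metric_space.mtopology X d)"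
    and "closed_relation (Metric_space.mtopology X d) F"
    and "sigma_transitive (Metric_space.mtopology X d) F"
  shows "transitive_system (mahavier_space (Metric_space.mtopology X d) F) shift"
  using assms(1,5)
  by (intro sigma_transitive_imp_transitive_system Hausdorff_imp_t1_space
      Metric_space.Hausdorff_space_mtopology)

end
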